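(* Let $G$ be a finite graph on $V(G)=\{x_1,\ldots,x_n\}$ which enjoys the strong exchange property and suppose that $x_n$ is a leaf of $G$. Then $G-x_n$ enjoys the strong exchange property.
   Context: All graphs are finite with no loop and no multiple edge, and $G$ has no isolated vertex. For a finite simple graph $G$ on $V(G)=\{x_1,\ldots,x_n\}$ with edge set $E(G)$, let $S=K[x_1,\ldots,x_n]$ be the polynomial ring over a field $K$. The edge ideal $I(G)\subset S$ is generated by the monomials $x_ix_j$ with $\{x_i,x_j\}\in E(G)$. For a monomial ideal $I\subset S$ and $\mathfrak{c}=(c_1,\ldots,c_n)\in\mathbb{Z}_{>0}^n$, $I_{\mathfrak{c}}$ is the ideal generated by the monomials $x_1^{a_1}\cdots x_n^{a_n}\in I$ with $a_i\le c_i$ for all $i$, and $\delta_{\mathfrak{c}}(I)$ is the largest integer $q$ with $(I^q)_{\mathfrak{c}}\neq 0$ (where $I^0=S$). Let $\mathcal{W}(\mathfrak{c},G)$ be the minimal set of monomial generators of $(I(G)^{\delta})_{\mathfrak{c}}$, where $\delta=\delta_{\mathfrak{c}}(I(G))$. $\mathcal{W}(\mathfrak{c},G)$ enjoys the strong exchange property if for all $w=x_1^{a_1}\cdots x_n^{a_n}$ and $w'=x_1^{b_1}\cdots x_n^{b_n}$ in $\mathcal{W}(\mathfrak{c},G)$ and all $\xi,\rho$ with $a_\xi>b_\xi$ and $a_\rho<b_\rho$, one has $x_\rho(w/x_\xi)\in\mathcal{W}(\mathfrak{c},G)$. The graph $G$ enjoys the strong exchange property if $\mathcal{W}(\mathfrak{c},G)$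 does for every $\mathfrak{c}\in\mathbb{Z}_{>0}^n$. A leaf is a vertex of degree one. $G-x_n$ is the induced subgraph of $G$ on $V(G)\setminus\{x_n\}$; the definitions above are applied to it with the polynomial ring $K[x_1,\ldots,x_{n-1}]$ and vectors in $\mathbb{Z}_{>0}^{n-1}$, also if it has an isolated vertex. *)

theory Defs
  imports "HOL-Library.Poly_Mapping" "HOL-Algebra.Ideal_Product"
begin

section \<open>Finite simple graphs\<close>

definition simple_graph :: "'v set \<Rightarrow> 'v set set \<Rightarrow> bool" where
  "simple_graph V E \<longleftrightarrow> finite V \<and> (\<forall>e\<in>E. e \<subseteq> V \<and> card e = 2)"

definition vertex_degree :: "'v set set \<Rightarrow> 'v \<Rightarrow> nat" where
  "vertex_degree E v = card {e \<in> E. v \<in> e}"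

definition isolated_vertex :: "'v set \<Rightarrow> 'v set set \<Rightarrow> 'v \<Rightarrow> bool" where
  "isolated_vertex V E v \<longleftrightarrow> v \<in> V \<and> vertex_degree E v = 0"

definition leaf :: "'v set \<Rightarrow> 'v set set \<Rightarrow> 'v \<Rightarrow> bool" where
  "leaf V E v \<longleftrightarrow> v \<in> V \<and> vertex_degree E v = 1"

definition induced_edges :: "'v set set \<Rightarrow> 'v set \<Rightarrow> 'v set set" where
  "induced_edges E U = {e \<in> E. e \<subseteq> U}"


section \<open>Polynomial rings and monomial ideals\<close>

text \<open>
  A monomial is identified with its exponent vector, a finitely supported map from the variables
  to the natural numbers. The variables of the polynomial ring of a graph are the vertices
  themselves, so that deleting a vertex changes the ring and not the type.
\<close>

type_synonym 'v mono = "'v \<Rightarrow>\<^sub>0 nat"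
type_synonym ('v, 'k) mpoly = "'v mono \<Rightarrow>\<^sub>0 'k"

definition monomials :: "'v set \<Rightarrow> 'v mono set" where
  "monomials V = {m. Poly_Mapping.keys m \<subseteq> V}"

definition mono_poly :: "'v mono \<Rightarrow> ('v, 'k::field) mpoly" where
  "mono_poly m = Poly_Mapping.single m 1"

definition poly_ring :: "'v set \<Rightarrow> ('v, 'k::field) mpoly ring" where
  "poly_ring V = \<lparr>carrier = {p. Poly_Mapping.keys p \<subseteq> monomials V},
     mult = (*), one = 1, zero = 0, add = (+)\<rparr>"

lemma poly_ring_cring: "cring (poly_ring V :: ('v, 'k::field) mpoly ring)"
proof -
  have mult_closed: "Poly_Mapping.keys (p * q) \<subseteq> monomials V"
    if "Poly_Mapping.keys p \<subseteq> monomials V" "Poly_Mapping.keys q \<subseteq> monomials V"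
    for p q :: "('v, 'k) mpoly"
  proof
    fix m assume "m \<in> Poly_Mapping.keys (p * q)"
    then obtain a b where m: "m = a + b" and "a \<in> Poly_Mapping.keys p" "b \<in> Poly_Mapping.keys q"
      using keys_mult[of p q] by auto
    then have "Poly_Mapping.keys a \<subseteq> V" "Poly_Mapping.keys b \<subseteq> V"
      using that by (auto simp: monomials_def)
    then show "m \<in> monomials V"
      using keys_add[of a b] by (auto simp: monomials_def m)
  qed
  have add_closed: "Poly_Mapping.keys (p + q) \<subseteq> monomials V"
    if "Poly_Mapping.keys p \<subseteq> monomials V" "Poly_Mapping.keys q \<subseteq> monomials V"
    for p q :: "('v, 'k) mpoly"
    using that keys_add[of p q] by blast
  have minus: "\<exists>q. Poly_Mapping.keys q \<subseteq> monomials V \<and> q + p = 0"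
    if "Poly_Mapping.keys p \<subseteq> monomials V" for p :: "('v, 'k) mpoly"
    using that by (intro exI[of _ "- p"]) simp
  have one: "Poly_Mapping.keys (1 :: ('v, 'k) mpoly) \<subseteq> monomials V"
    by (simp add: monomials_def)
  show ?thesis
  proof (intro cringI abelian_groupI comm_monoidI)
    fix p assume "p \<in> carrier (poly_ring V :: ('v, 'k) mpoly ring)"
    then show "\<exists>q\<in>carrier (poly_ring V). q \<oplus>\<^bsub>poly_ring V\<^esub> p = \<zero>\<^bsub>poly_ring V\<^esub>"
      using minus[of p] by (auto simp: poly_ring_def)
  qed (use mult_closed add_closed one in \<open>simp_all add: poly_ring_def algebra_simps\<close>)
qed

definition mono_ideal :: "'v set \<Rightarrow> 'v mono set \<Rightarrow> ('v, 'k::field) mpoly set" where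
  "mono_ideal V M = genideal (poly_ring V) (mono_poly ` M)"

definition bounded_part ::
  "'v set \<Rightarrow> ('v \<Rightarrow> nat) \<Rightarrow> ('v, 'k::field) mpoly set \<Rightarrow> ('v, 'k) mpoly set" where
  "bounded_part V c I =
     mono_ideal V {m \<in> monomials V. mono_poly m \<in> I \<and> (\<forall>v\<in>V. Poly_Mapping.lookup m v \<le> c v)}"

text \<open>The power of order 0 is the unit of the monoid of ideals, that is, the whole ring.\<close>

definition ideal_power :: "'v set \<Rightarrow> ('v, 'k::field) mpoly set \<Rightarrow> nat \<Rightarrow> ('v, 'k) mpoly set" where
  "ideal_power V I q = I [^]\<^bsub>ideals_set (poly_ring V)\<^esub> q"

text \<open>
  For a proper monomial ideal the integers in question are bounded by the sum of the entries
  of \<open>c\<close>, and 0 is one of them, so the greatest one exists.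
\<close>

definition delta :: "'v set \<Rightarrow> ('v \<Rightarrow> nat) \<Rightarrow> ('v, 'k::field) mpoly set \<Rightarrow> nat" where
  "delta V c I = (GREATEST q. bounded_part V c (ideal_power V I q) \<noteq> {0})"

definition is_minimal_mono_gens ::
  "'v set \<Rightarrow> ('v, 'k::field) mpoly set \<Rightarrow> 'v mono set \<Rightarrow> bool" where
  "is_minimal_mono_gens V I M \<longleftrightarrow>
     M \<subseteq> monomials V \<and> mono_ideal V M = I \<and> (\<forall>M'. M' \<subset> M \<longrightarrow> mono_ideal V M' \<noteq> I)"

text \<open>Every monomial ideal has exactly one inclusion-minimal set of monomial generators.\<close>

definition minimal_mono_gens :: "'v set \<Rightarrow> ('v, 'k::field) mpoly set \<Rightarrow> 'v mono set" where
  "minimal_mono_gens V I = (THE M. is_minimal_mono_gens V I M)"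


section \<open>Edge ideals and the strong exchange property\<close>

definition edge_ideal :: "'v set \<Rightarrow> 'v set set \<Rightarrow> ('v, 'k::field) mpoly set" where
  "edge_ideal V E =
     mono_ideal V {Poly_Mapping.single u 1 + Poly_Mapping.single v 1 | u v. {u, v} \<in> E}"

text \<open>The type argument carries the coefficient field.\<close>

definition graph_gens ::
  "'k::field itself \<Rightarrow> 'v set \<Rightarrow> 'v set set \<Rightarrow> ('v \<Rightarrow> nat) \<Rightarrow> 'v mono set" where
  "graph_gens K V E c =
     (let I = (edge_ideal V E :: ('v, 'k) mpoly set)
      in minimal_mono_gens V (bounded_part V c (ideal_power V I (delta V c I))))"

definition strong_exchange :: "'v set \<Rightarrow> 'v mono set \<Rightarrow> bool" where
  "strong_exchange V W \<longleftrightarrow>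
     (\<forall>w\<in>W. \<forall>w'\<in>W. \<forall>\<xi>\<in>V. \<forall>\<rho>\<in>V.
        Poly_Mapping.lookup w \<xi> > Poly_Mapping.lookup w' \<xi> \<and>
        Poly_Mapping.lookup w \<rho> < Poly_Mapping.lookup w' \<rho> \<longrightarrow>
        Poly_Mapping.single \<rho> 1 + (w - Poly_Mapping.single \<xi> 1) \<in> W)"

text \<open>The values of \<open>c\<close> outside \<open>V\<close> play no role.\<close>

definition graph_strong_exchange :: "'k::field itself \<Rightarrow> 'v set \<Rightarrow> 'v set set \<Rightarrow> bool" where
  "graph_strong_exchange K V E \<longleftrightarrow>
     (\<forall>c. (\<forall>v\<in>V. c v > 0) \<longrightarrow> strong_exchange V (graph_gens K V E c))"

end

theory Submission
  imports Defs
begin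

text \<open>
  The argument is about edge products only. A monomial of \<open>I(G)\<^sup>q\<close> is a multiple of a
  product of \<open>q\<close> edges, and these products all have degree \<open>2 q\<close>. Hence \<open>\<delta>\<close> is the greatest
  length of a product of edges bounded by \<open>c\<close>, and the minimal generators in question are
  exactly the bounded products of that length (lemma \<open>graph_gens_eq\<close>).

  Let \<open>y\<close> be the neighbour of the leaf \<open>x\<close>, and let \<open>c\<close> be a bound for \<open>G - x\<close>. Extend it to
  \<open>G\<close> by allowing \<open>x\<close> once and \<open>y\<close> once more than before. The edge \<open>xy\<close> can then always be added
  to a bounded product of \<open>G - x\<close>. Conversely, every nonempty bounded product of \<open>G\<close> contains a
  factor whose removal leaves a bounded product of \<open>G - x\<close>: the edge \<open>xy\<close> if \<open>x\<close> occurs, otherwise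
  an edge at \<open>y\<close> if \<open>y\<close> occurs, otherwise any edge. So \<open>\<delta>\<close> grows by exactly one
  (lemma \<open>bounded_edge_products_leaf\<close>), and multiplication by \<open>xy\<close> sends the generators
  of \<open>G - x\<close> into those of \<open>G\<close>. An exchange between two images does not touch the exponent 1
  of \<open>x\<close>. The result of the exchange therefore has \<open>xy\<close> as a factor exactly once, since \<open>x\<close> lies
  on no other edge, and cancelling it gives the exchange for \<open>G - x\<close>.
\<close>

section \<open>Monomial ideals\<close>

definition mono_multiples :: "'v set \<Rightarrow> 'v mono set \<Rightarrow> 'v mono set" where
  "mono_multiples V M = {k \<in> monomials V. \<exists>m\<in>M. \<exists>a. k = m + a}"

lemma keys_add_mono: "Poly_Mapping.keys (a + b :: 'v mono) = Poly_Mapping.keys a \<union> Poly_Mapping.keys b"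
  by (auto simp: in_keys_iff lookup_add)

lemma add_in_monomials_iff: "a + b \<in> monomials V \<longleftrightarrow> a \<in> monomials V \<and> b \<in> monomials V"
  by (auto simp: monomials_def keys_add_mono)

lemma mono_multiples_self: "M \<subseteq> monomials V \<Longrightarrow> M \<subseteq> mono_multiples V M"
  unfolding mono_multiples_def by (auto intro!: bexI exI[of _ 0])

lemma mono_multiples_add:
  assumes "k \<in> mono_multiples V M" "b \<in> monomials V"
  shows "k + b \<in> mono_multiples V M"
proof -
  from assms obtain m a where "m \<in> M" "k = m + a" "k \<in> monomials V"
    by (auto simp: mono_multiples_def)
  then show ?thesis
    using assms(2) unfolding mono_multiples_def
    by (auto simp: add_in_monomials_iff add.assoc)
qed

lemma poly_mapping_sum_single:
  "p = (\<Sum>k\<in>Poly_Mapping.keys p. Poly_Mapping.single k (Poly_Mapping.lookup p k))"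
proof (rule poly_mapping_eqI)
  fix k
  have "(\<Sum>j\<in>Poly_Mapping.keys p. Poly_Mapping.lookup p j when j = k) = Poly_Mapping.lookup p k"
    by (cases "k \<in> Poly_Mapping.keys p") (auto simp: when_def in_keys_iff)
  then show "Poly_Mapping.lookup p k = Poly_Mapping.lookup
      (\<Sum>k\<in>Poly_Mapping.keys p. Poly_Mapping.single k (Poly_Mapping.lookup p k)) k"
    by (simp add: lookup_sum lookup_single)
qed

text \<open>
  The polynomials on the right form an ideal, because every monomial of a product is a multiple
  of a monomial of each factor. They lie in the generated ideal because each of their terms is
  a generator times a term.
\<close>

lemma mono_ideal_eq:
  fixes M :: "'v mono set"
  assumes M: "M \<subseteq> monomials V"
  shows "(mono_ideal V M :: ('v, 'k::field) mpoly set) = {p. Poly_Mapping.keys p \<subseteq> mono_multiples V M}"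
    (is "_ = ?J")
    and "ideal (mono_ideal V M :: ('v, 'k) mpoly set) (poly_ring V)"
proof -
  let ?R = "poly_ring V :: ('v, 'k) mpoly ring"
  interpret R: cring ?R by (rule poly_ring_cring)
  have carr: "carrier ?R = {p. Poly_Mapping.keys p \<subseteq> monomials V}"
    and ops: "\<And>p q. p \<otimes>\<^bsub>?R\<^esub> q = p * q" "\<And>p q. p \<oplus>\<^bsub>?R\<^esub> q = p + q" "\<zero>\<^bsub>?R\<^esub> = 0"
    by (simp_all add: poly_ring_def)
  have JR: "?J \<subseteq> carrier ?R" by (auto simp: carr mono_multiples_def)
  have gens: "mono_poly ` M \<subseteq> ?J"
    using mono_multiples_self[OF M] by (auto simp: mono_poly_def)
  have minus: "\<ominus>\<^bsub>?R\<^esub> p = - p" if "p \<in> carrier ?R" for p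
    by (rule R.minus_equality) (use that in \<open>auto simp: ops carr\<close>)
  have mult: "p * q \<in> ?J" if p: "p \<in> ?J" and q: "q \<in> carrier ?R" for p q
  proof -
    have "k \<in> mono_multiples V M" if k: "k \<in> Poly_Mapping.keys (p * q)" for k
    proof -
      obtain a b where "k = a + b" "a \<in> Poly_Mapping.keys p" "b \<in> Poly_Mapping.keys q"
        using k keys_mult[of p q] by blast
      then show ?thesis using p q mono_multiples_add[of a V M b] by (auto simp: carr)
    qed
    then show ?thesis by auto
  qed
  have J: "ideal ?J ?R"
  proof (rule idealI)
    show "ring ?R" by (rule R.ring_axioms)
    show "subgroup ?J (add_monoid ?R)"
    proof (rule R.add.subgroupI)
      show "?J \<subseteq> carrier ?R" by (rule JR)
      show "?J \<noteq> {}" by (auto intro: exI[of _ 0])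
    next
      fix p assume "p \<in> ?J"
      then show "\<ominus>\<^bsub>?R\<^esub> p \<in> ?J" using JR minus[of p] by (simp add: subset_iff)
    next
      fix p q assume "p \<in> ?J" "q \<in> ?J"
      then show "p \<oplus>\<^bsub>?R\<^esub> q \<in> ?J" using keys_add[of p q] by (auto simp: ops)
    qed
    fix p q assume "p \<in> ?J" "q \<in> carrier ?R"
    then show "q \<otimes>\<^bsub>?R\<^esub> p \<in> ?J" "p \<otimes>\<^bsub>?R\<^esub> q \<in> ?J"
      using mult[of p q] by (simp_all add: ops mult.commute)
  qed
  have I: "ideal (mono_ideal V M) ?R"
    unfolding mono_ideal_def using gens JR by (intro R.genideal_ideal) auto
  have M_I: "mono_poly ` M \<subseteq> (mono_ideal V M :: ('v, 'k) mpoly set)"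
    unfolding mono_ideal_def using gens JR by (intro R.genideal_self) auto
  interpret I: ideal "mono_ideal V M" ?R by (rule I)
  have term_I: "Poly_Mapping.single k c \<in> mono_ideal V M"
    if k: "k \<in> mono_multiples V M" for k and c :: 'k
  proof -
    obtain m a where m: "m \<in> M" "k = m + a" and "k \<in> monomials V"
      using k by (auto simp: mono_multiples_def)
    then have "Poly_Mapping.single a c \<in> carrier ?R"
      by (auto simp: carr add_in_monomials_iff)
    moreover have "mono_poly m \<in> (mono_ideal V M :: ('v, 'k) mpoly set)" using M_I m by auto
    ultimately have "mono_poly m * Poly_Mapping.single a c \<in> mono_ideal V M"
      using I.I_r_closed by (simp add: ops)
    then show ?thesis by (simp add: mono_poly_def mult_single m)
  qed
  have "?J \<subseteq> mono_ideal V M"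
  proof
    fix p :: "('v, 'k) mpoly" assume p: "p \<in> ?J"
    have "(\<Sum>k\<in>A. Poly_Mapping.single k (Poly_Mapping.lookup p k)) \<in> mono_ideal V M"
      if "finite A" "A \<subseteq> mono_multiples V M" for A
      using that
    proof (induction A)
      case empty
      show ?case using I.zero_closed by (simp add: ops)
    next
      case (insert k A)
      then show ?case using I.a_closed term_I by (simp add: ops)
    qed
    then show "p \<in> mono_ideal V M"
      using p by (subst poly_mapping_sum_single) auto
  qed
  moreover have "mono_ideal V M \<subseteq> ?J"
    unfolding mono_ideal_def by (rule R.genideal_minimal[OF J gens])
  ultimately show "mono_ideal V M = ?J" by blast
  show "ideal (mono_ideal V M) ?R" by (rule I)
qed

lemma mono_poly_in_mono_ideal_iff:
  fixes M :: "'v mono set"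
  assumes "M \<subseteq> monomials V"
  shows "(mono_poly k :: ('v, 'k::field) mpoly) \<in> mono_ideal V M \<longleftrightarrow> k \<in> mono_multiples V M"
  by (simp add: mono_ideal_eq[OF assms] mono_poly_def)

lemma mono_ideal_subset_iff:
  fixes M :: "'v mono set"
  assumes "M \<subseteq> monomials V" "N \<subseteq> monomials V"
  shows "(mono_ideal V M :: ('v, 'k::field) mpoly set) \<subseteq> mono_ideal V N \<longleftrightarrow> M \<subseteq> mono_multiples V N"
proof
  assume "(mono_ideal V M :: ('v, 'k) mpoly set) \<subseteq> mono_ideal V N"
  then show "M \<subseteq> mono_multiples V N"
    using mono_multiples_self[OF assms(1)]
      mono_poly_in_mono_ideal_iff[OF assms(1), where ?'k = 'k]
      mono_poly_in_mono_ideal_iff[OF assms(2), where ?'k = 'k] by blast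
next
  assume *: "M \<subseteq> mono_multiples V N"
  have "mono_multiples V M \<subseteq> mono_multiples V N"
  proof
    fix k assume "k \<in> mono_multiples V M"
    then obtain m a where "m \<in> M" "k = m + a" "k \<in> monomials V"
      by (auto simp: mono_multiples_def)
    then show "k \<in> mono_multiples V N"
      using * mono_multiples_add[of m V N a] by (auto simp: add_in_monomials_iff)
  qed
  then show "(mono_ideal V M :: ('v, 'k) mpoly set) \<subseteq> mono_ideal V N"
    by (auto simp: mono_ideal_eq assms)
qed

lemma mono_ideal_prod:
  fixes M N :: "'v mono set"
  assumes M: "M \<subseteq> monomials V" and N: "N \<subseteq> monomials V"
  shows "ideal_prod (poly_ring V) (mono_ideal V M) (mono_ideal V N) =
    (mono_ideal V {m + n | m n. m \<in> M \<and> n \<in> N} :: ('v, 'k::field) mpoly set)" (is "?P = ?I")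
proof
  let ?R = "poly_ring V :: ('v, 'k) mpoly ring"
  let ?S = "{m + n | m n. m \<in> M \<and> n \<in> N}"
  interpret R: cring ?R by (rule poly_ring_cring)
  have S: "?S \<subseteq> monomials V" using M N by (auto simp: add_in_monomials_iff)
  have P: "ideal ?P ?R"
    by (intro R.ideal_prod_is_ideal mono_ideal_eq(2) M N)
  show "?P \<subseteq> ?I"
  proof
    fix s assume "s \<in> ?P"
    then show "s \<in> ?I"
    proof induction
      case (prod p q)
      have "k \<in> mono_multiples V ?S" if k: "k \<in> Poly_Mapping.keys (p * q)" for k
      proof -
        obtain a b where k_eq: "k = a + b" and ab: "a \<in> Poly_Mapping.keys p" "b \<in> Poly_Mapping.keys q"
          using k keys_mult[of p q] by blast
        have "a \<in> mono_multiples V M" "b \<in> mono_multiples V N"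
          using ab prod by (auto simp: mono_ideal_eq M N)
        then obtain m a' n b' where "m \<in> M" "a = m + a'" "n \<in> N" "b = n + b'"
          and *: "a \<in> monomials V" "b \<in> monomials V"
          by (auto simp: mono_multiples_def)
        then have "m + n \<in> ?S" "k = (m + n) + (a' + b')" by (auto simp: k_eq ac_simps)
        moreover have "k \<in> monomials V" using * by (simp add: k_eq add_in_monomials_iff)
        ultimately show ?thesis unfolding mono_multiples_def by blast
      qed
      then show ?case by (auto simp: mono_ideal_eq[OF S] poly_ring_def)
    next
      case (sum s t)
      then show ?case using keys_add[of s t] by (auto simp: mono_ideal_eq[OF S] poly_ring_def)
    qed
  qed
  show "?I \<subseteq> ?P"
    unfolding mono_ideal_def[of V ?S]
  proof (rule R.genideal_minimal[OF P], clarify)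
    fix m n assume "m \<in> M" "n \<in> N"
    then have "mono_poly m \<in> (mono_ideal V M :: ('v, 'k) mpoly set)"
      "mono_poly n \<in> (mono_ideal V N :: ('v, 'k) mpoly set)"
      using mono_multiples_self[OF M] mono_multiples_self[OF N]
      by (auto simp: mono_poly_in_mono_ideal_iff M N)
    from ideal_prod.prod[OF this, of ?R] show "mono_poly (m + n) \<in> ?P"
      by (simp add: poly_ring_def mono_poly_def mult_single)
  qed
qed

text \<open>A bounded multiple of \<open>m\<close> comes from a bounded \<open>m\<close>, so only the generators need a bound.\<close>

lemma bounded_part_mono_ideal:
  fixes N :: "'v mono set"
  assumes N: "N \<subseteq> monomials V"
  shows "bounded_part V c (mono_ideal V N) =
    (mono_ideal V {m \<in> N. \<forall>v\<in>V. Poly_Mapping.lookup m v \<le> c v} :: ('v, 'k::field) mpoly set)"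
    (is "_ = mono_ideal V ?B")
proof -
  let ?A = "{m \<in> monomials V. m \<in> mono_multiples V N \<and> (\<forall>v\<in>V. Poly_Mapping.lookup m v \<le> c v)}"
  have "?A \<subseteq> mono_multiples V ?B"
  proof
    fix k assume k: "k \<in> ?A"
    then obtain m a where "m \<in> N" "k = m + a" by (auto simp: mono_multiples_def)
    moreover have "\<forall>v\<in>V. Poly_Mapping.lookup m v \<le> c v"
    proof
      fix v assume "v \<in> V"
      then have "Poly_Mapping.lookup (m + a) v \<le> c v" using k \<open>k = m + a\<close> by auto
      then show "Poly_Mapping.lookup m v \<le> c v" by (simp add: lookup_add)
    qed
    ultimately show "k \<in> mono_multiples V ?B" using k by (auto simp: mono_multiples_def)
  qed
  moreover have "?B \<subseteq> mono_multiples V ?A"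
    using mono_multiples_self[of ?A V] mono_multiples_self[OF N] N by auto
  moreover have "?B \<subseteq> monomials V" using N by auto
  ultimately have "(mono_ideal V ?A :: ('v, 'k) mpoly set) = mono_ideal V ?B"
    by (intro subset_antisym) (auto simp: mono_ideal_subset_iff)
  then show ?thesis
    by (simp add: bounded_part_def mono_poly_in_mono_ideal_iff[OF N])
qed

lemma mono_ideal_eq_zero_iff:
  fixes M :: "'v mono set"
  assumes M: "M \<subseteq> monomials V"
  shows "(mono_ideal V M :: ('v, 'k::field) mpoly set) = {0} \<longleftrightarrow> M = {}"
proof
  assume eq: "(mono_ideal V M :: ('v, 'k) mpoly set) = {0}"
  have "(mono_poly m :: ('v, 'k) mpoly) \<in> mono_ideal V M" if "m \<in> M" for m
    using that mono_multiples_self[OF M] by (auto simp: mono_poly_in_mono_ideal_iff M)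
  moreover have "(mono_poly m :: ('v, 'k) mpoly) \<noteq> 0" for m
    by (metis keys_single keys_zero insert_not_empty mono_poly_def one_neq_zero)
  ultimately show "M = {}" unfolding eq by blast
qed (auto simp: mono_ideal_eq mono_multiples_def)

text \<open>
  Any generating set contains an element dividing a given element of the antichain, which in turn
  is divisible by an element of the antichain; so all three coincide. Hence every generating set
  contains the antichain.
\<close>

lemma minimal_mono_gens_antichain:
  fixes N :: "'v mono set"
  assumes N: "N \<subseteq> monomials V"
    and anti: "\<And>m a. m \<in> N \<Longrightarrow> m + a \<in> N \<Longrightarrow> a = 0"
  shows "minimal_mono_gens V (mono_ideal V N :: ('v, 'k::field) mpoly set) = N"
proof -
  have sub: "N \<subseteq> M"
    if M: "M \<subseteq> monomials V" and eq: "(mono_ideal V M :: ('v, 'k) mpoly set) = mono_ideal V N" for M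
  proof
    fix n assume n: "n \<in> N"
    have "N \<subseteq> mono_multiples V M" "M \<subseteq> mono_multiples V N"
      using mono_ideal_subset_iff[OF N M, where ?'k = 'k]
        mono_ideal_subset_iff[OF M N, where ?'k = 'k] eq by auto
    with n obtain m a n' b where m: "m \<in> M" "n = m + a" and n': "n' \<in> N" "m = n' + b"
      by (fastforce simp: mono_multiples_def)
    have "n' + (b + a) \<in> N" using n m n' by (simp add: add.assoc)
    from anti[OF n'(1) this] have "Poly_Mapping.keys (b + a) = {}" by simp
    then have "a = 0" by (simp add: keys_add_mono)
    then show "n \<in> M" using m by simp
  qed
  show ?thesis unfolding minimal_mono_gens_def
  proof (rule the_equality)
    show "is_minimal_mono_gens V (mono_ideal V N :: ('v, 'k) mpoly set) N"
      unfolding is_minimal_mono_gens_def using N sub by blast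
  next
    fix M assume "is_minimal_mono_gens V (mono_ideal V N :: ('v, 'k) mpoly set) M"
    then show "M = N"
      using sub unfolding is_minimal_mono_gens_def by blast
  qed
qed


section \<open>Edge products and the generators of a graph\<close>

definition edge_mono :: "'v \<Rightarrow> 'v \<Rightarrow> 'v mono" where
  "edge_mono u v = Poly_Mapping.single u 1 + Poly_Mapping.single v 1"

fun edge_products :: "'v set set \<Rightarrow> nat \<Rightarrow> 'v mono set" where
  "edge_products E 0 = {0}"
| "edge_products E (Suc q) = {m + e | m e. m \<in> edge_products E q \<and> e \<in> {edge_mono u v | u v. {u, v} \<in> E}}"

definition bounded_edge_products :: "'v set \<Rightarrow> 'v set set \<Rightarrow> ('v \<Rightarrow> nat) \<Rightarrow> nat \<Rightarrow> 'v mono set" where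
  "bounded_edge_products V E c q = {m \<in> edge_products E q. \<forall>v\<in>V. Poly_Mapping.lookup m v \<le> c v}"

lemma lookup_edge_mono:
  "Poly_Mapping.lookup (edge_mono u v) w = (if w = u then 1 else 0) + (if w = v then 1 else 0)"
  by (auto simp: edge_mono_def lookup_add lookup_single)

lemma edge_mono_commute: "edge_mono u v = edge_mono v u"
  by (simp add: edge_mono_def add.commute)

lemma simple_graph_edge:
  assumes "simple_graph V E" "{u, v} \<in> E"
  shows "u \<in> V" "v \<in> V" "u \<noteq> v"
  using assms by (auto simp: simple_graph_def)

lemma edge_monos_subset_monomials:
  assumes "simple_graph V E"
  shows "{edge_mono u v | u v. {u, v} \<in> E} \<subseteq> monomials V"
  using simple_graph_edge[OF assms] by (auto simp: monomials_def edge_mono_def keys_add_mono)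

lemma edge_products_subset_monomials:
  assumes "simple_graph V E"
  shows "edge_products E q \<subseteq> monomials V"
proof (induction q)
  case (Suc q)
  then show ?case
    using edge_monos_subset_monomials[OF assms] by (auto 4 3 simp: add_in_monomials_iff)
qed (simp add: monomials_def)

lemma edge_products_degree:
  assumes G: "simple_graph V E" and "m \<in> edge_products E q"
  shows "(\<Sum>v\<in>V. Poly_Mapping.lookup m v) = 2 * q"
  using assms(2)
proof (induction q arbitrary: m)
  case (Suc q)
  then obtain m' u v where m: "m = m' + edge_mono u v" "m' \<in> edge_products E q" "{u, v} \<in> E"
    by auto
  have "finite V" using G by (simp add: simple_graph_def)
  then have "(\<Sum>w\<in>V. Poly_Mapping.lookup (edge_mono u v) w) = 2"
    using simple_graph_edge[OF G m(3)] by (simp add: lookup_edge_mono sum.distrib)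
  then show ?case using Suc.IH[OF m(2)] by (simp add: m lookup_add sum.distrib)
qed simp

lemma ideal_power_edge_ideal:
  fixes V :: "'v set"
  assumes G: "simple_graph V E"
  shows "ideal_power V (edge_ideal V E :: ('v, 'k::field) mpoly set) q = mono_ideal V (edge_products E q)"
proof (induction q)
  case 0
  have 0: "{0} \<subseteq> monomials V" by (simp add: monomials_def)
  have "mono_multiples V {0} = monomials V" by (auto simp: mono_multiples_def)
  then show ?case
    by (simp add: ideal_power_def ideals_set_def mono_ideal_eq[OF 0] poly_ring_def)
next
  case (Suc q)
  have "ideal_power V (edge_ideal V E :: ('v, 'k) mpoly set) (Suc q) =
    ideal_prod (poly_ring V) (ideal_power V (edge_ideal V E) q) (edge_ideal V E)"
    by (simp add: ideal_power_def ideals_set_def nat_pow_def)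
  also have "\<dots> = ideal_prod (poly_ring V) (mono_ideal V (edge_products E q))
      (mono_ideal V {edge_mono u v | u v. {u, v} \<in> E})"
    unfolding Suc unfolding edge_ideal_def edge_mono_def ..
  also have "\<dots> = mono_ideal V (edge_products E (Suc q))"
    by (simp only: mono_ideal_prod[OF edge_products_subset_monomials[OF G]
          edge_monos_subset_monomials[OF G]] edge_products.simps)
  finally show ?case .
qed

text \<open>
  Products of the same number of edges have the same degree, so none of them properly divides
  another: the bounded ones already form a minimal generating set.
\<close>

lemma graph_gens_eq:
  fixes V :: "'v set"
  assumes G: "simple_graph V E"
  shows "graph_gens TYPE('k::field) V E c =
    bounded_edge_products V E c (GREATEST q. bounded_edge_products V E c q \<noteq> {})"
proof -
  let ?I = "edge_ideal V E :: ('v, 'k) mpoly set"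
  let ?B = "bounded_edge_products V E c"
  have sub: "?B q \<subseteq> monomials V" for q
    using edge_products_subset_monomials[OF G] by (auto simp: bounded_edge_products_def)
  have part: "bounded_part V c (ideal_power V ?I q) = mono_ideal V (?B q)" for q
    by (simp add: ideal_power_edge_ideal[OF G] bounded_edge_products_def
        bounded_part_mono_ideal[OF edge_products_subset_monomials[OF G]])
  have "delta V c ?I = (GREATEST q. ?B q \<noteq> {})"
    by (simp add: delta_def part mono_ideal_eq_zero_iff[OF sub])
  moreover have "minimal_mono_gens V (mono_ideal V (?B q) :: ('v, 'k) mpoly set) = ?B q" for q
  proof (rule minimal_mono_gens_antichain[OF sub])
    fix m a assume ma: "m \<in> ?B q" "m + a \<in> ?B q"
    then have "(\<Sum>v\<in>V. Poly_Mapping.lookup m v) = 2 * q"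
      "(\<Sum>v\<in>V. Poly_Mapping.lookup (m + a) v) = 2 * q"
      using edge_products_degree[OF G] by (auto simp: bounded_edge_products_def)
    then have "(\<Sum>v\<in>V. Poly_Mapping.lookup a v) = 0"
      by (simp add: lookup_add sum.distrib)
    moreover have "finite V" using G by (simp add: simple_graph_def)
    ultimately have "\<forall>v\<in>V. Poly_Mapping.lookup a v = 0" by simp
    moreover have "a \<in> monomials V" using ma(2) sub add_in_monomials_iff by blast
    ultimately have "Poly_Mapping.lookup a v = 0" for v
      by (cases "v \<in> V") (auto simp: monomials_def in_keys_iff)
    then show "a = 0" by (intro poly_mapping_eqI) simp
  qed
  ultimately show ?thesis by (simp add: graph_gens_def Let_def part)
qed


section \<open>Adding and removing the edge at a leaf\<close>

lemma edge_products_mono: "E' \<subseteq> E \<Longrightarrow> edge_products E' q \<subseteq> edge_products E q"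
  by (induction q) (auto, blast)

lemma edge_products_SucI:
  "m \<in> edge_products E q \<Longrightarrow> {u, v} \<in> E \<Longrightarrow> m + edge_mono u v \<in> edge_products E (Suc q)"
  by auto

text \<open>
  A monomial may factor into edges in several ways. Since factors commute, a vertex that occurs
  in the monomial can be assumed to lie on the last one.
\<close>

lemma edge_products_factor_at:
  assumes "m \<in> edge_products E (Suc q)" "Poly_Mapping.lookup m v > 0"
  shows "\<exists>m' u. {u, v} \<in> E \<and> m' \<in> edge_products E q \<and> m = m' + edge_mono u v"
  using assms
proof (induction q arbitrary: m)
  case 0
  then obtain a b where ab: "{a, b} \<in> E" "m = edge_mono a b" by auto
  then have "v = a \<or> v = b"
    using 0(2) by (auto simp: lookup_edge_mono split: if_splits)
  then have "\<exists>u. {u, v} \<in> E \<and> m = edge_mono u v"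
    using ab edge_mono_commute insert_commute by metis
  then show ?case by simp
next
  case (Suc q)
  obtain m1 a b where m: "m = m1 + edge_mono a b" and m1: "m1 \<in> edge_products E (Suc q)"
    and ab: "{a, b} \<in> E"
    using Suc.prems(1) by (subst (asm) edge_products.simps) blast
  show ?case
  proof (cases "v = a \<or> v = b")
    case True
    then show ?thesis
    proof
      assume "v = a"
      then have "{b, v} \<in> E" "m = m1 + edge_mono b v"
        using m ab by (simp_all add: edge_mono_commute insert_commute)
      then show ?thesis using m1 by blast
    next
      assume "v = b"
      then show ?thesis using m m1 ab by blast
    qed
  next
    case False
    then have "Poly_Mapping.lookup m1 v > 0"
      using Suc.prems(2) by (simp add: m lookup_add lookup_edge_mono)
    from Suc.IH[OF m1 this] obtain m' u
      where u: "{u, v} \<in> E" "m' \<in> edge_products E q" "m1 = m' + edge_mono u v" by blast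
    from edge_products_SucI[OF u(2) ab] have "m' + edge_mono a b \<in> edge_products E (Suc q)" .
    moreover have "m = (m' + edge_mono a b) + edge_mono u v" by (simp add: m u ac_simps)
    ultimately show ?thesis using u(1) by blast
  qed
qed

lemma edge_products_delete_vertex:
  assumes G: "simple_graph V E" and "m \<in> edge_products E q" "Poly_Mapping.lookup m x = 0"
  shows "m \<in> edge_products (induced_edges E (V - {x})) q"
  using assms(2,3)
proof (induction q arbitrary: m)
  case (Suc q)
  then obtain m' u v where m: "m = m' + edge_mono u v" "m' \<in> edge_products E q" and uv: "{u, v} \<in> E"
    by auto
  have "Poly_Mapping.lookup m' x = 0" "u \<noteq> x" "v \<noteq> x"
    using Suc.prems(2) by (auto simp: m lookup_add lookup_edge_mono split: if_splits)
  then have "{u, v} \<in> induced_edges E (V - {x})"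
    using uv simple_graph_edge[OF G uv] by (simp add: induced_edges_def)
  then show ?case
    unfolding m(1) using \<open>Poly_Mapping.lookup m' x = 0\<close> by (intro edge_products_SucI Suc.IH m(2))
qed simp

lemma simple_graph_delete_vertex:
  "simple_graph V E \<Longrightarrow> simple_graph (V - {x}) (induced_edges E (V - {x}))"
  by (auto simp: simple_graph_def induced_edges_def)

lemma leaf_obtain_neighbour:
  assumes G: "simple_graph V E" and "leaf V E x"
  obtains y where "y \<noteq> x" "\<And>u. {u, x} \<in> E \<longleftrightarrow> u = y"
proof -
  obtain e where e: "{e \<in> E. x \<in> e} = {e}"
    using assms(2) unfolding leaf_def vertex_degree_def by (metis card_1_singletonE)
  then have "e \<in> E" "x \<in> e" by blast+
  have unique: "e' = e" if "e' \<in> E" "x \<in> e'" for e'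
    using that e by blast
  have "card e = 2" using G \<open>e \<in> E\<close> by (auto simp: simple_graph_def)
  then obtain a b where "e = {a, b}" "a \<noteq> b" by (auto simp: card_2_iff)
  then obtain y where y: "e = {y, x}" "y \<noteq> x"
    using \<open>x \<in> e\<close> by (metis insertE insert_commute singletonD)
  have "{u, x} \<in> E \<longleftrightarrow> u = y" for u
  proof
    assume "{u, x} \<in> E"
    then have "{u, x} = {y, x}" using unique y(1) by blast
    then show "u = y" by (auto simp: doubleton_eq_iff)
  next
    assume "u = y"
    then show "{u, x} \<in> E" using \<open>e \<in> E\<close> y by simp
  qed
  then show ?thesis using that y by blast
qed

locale leaf_edge =
  fixes V :: "'v set" and E :: "'v set set" and x y :: 'v
  assumes G: "simple_graph V E"
    and y: "y \<noteq> x"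
    and leaf_edge_iff: "{u, x} \<in> E \<longleftrightarrow> u = y"
begin

abbreviation "V' \<equiv> V - {x}"
abbreviation "E' \<equiv> induced_edges E V'"

text \<open>
  The entry 1 at \<open>x\<close> leaves room for the leaf edge just once, and the increment at \<open>y\<close> is what
  that edge uses up there; after removing it, exactly the bound \<open>c\<close> remains.
\<close>

definition extended_bound :: "('v \<Rightarrow> nat) \<Rightarrow> 'v \<Rightarrow> nat" where
  "extended_bound c = c(x := 1, y := Suc (c y))"

lemma edge_products_deleted_lookup:
  "m \<in> edge_products E' q \<Longrightarrow> Poly_Mapping.lookup m x = 0"
  using edge_products_subset_monomials[OF simple_graph_delete_vertex[OF G]]
  by (fastforce simp: monomials_def in_keys_iff)

lemma times_leaf_edge:
  assumes "m \<in> bounded_edge_products V' E' c q"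
  shows "m + edge_mono y x \<in> bounded_edge_products V E (extended_bound c) (Suc q)"
proof -
  have m: "m \<in> edge_products E' q" "\<forall>v\<in>V'. Poly_Mapping.lookup m v \<le> c v"
    using assms by (auto simp: bounded_edge_products_def)
  have "m \<in> edge_products E q"
    using m(1) edge_products_mono[of E' E] by (auto simp: induced_edges_def)
  then have "m + edge_mono y x \<in> edge_products E (Suc q)"
    using leaf_edge_iff by (intro edge_products_SucI) auto
  then show ?thesis
    using m(2) edge_products_deleted_lookup[OF m(1)] y
    by (auto simp: bounded_edge_products_def lookup_add lookup_edge_mono extended_bound_def)
qed

text \<open>The leaf edge is the only factor that can account for \<open>x\<close>, so it can be cancelled.\<close>

lemma cancel_leaf_edge:
  assumes "m + edge_mono y x \<in> bounded_edge_products V E (extended_bound c) (Suc q)"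
  shows "m \<in> bounded_edge_products V' E' c q"
proof -
  have prod: "m + edge_mono y x \<in> edge_products E (Suc q)"
    and bd: "\<forall>v\<in>V. Poly_Mapping.lookup (m + edge_mono y x) v \<le> extended_bound c v"
    using assms by (auto simp: bounded_edge_products_def)
  have "Poly_Mapping.lookup (m + edge_mono y x) x > 0"
    by (simp add: lookup_add lookup_edge_mono)
  from edge_products_factor_at[OF prod this] obtain m' u
    where "{u, x} \<in> E" "m' \<in> edge_products E q" "m + edge_mono y x = m' + edge_mono u x"
    by blast
  then have m: "m \<in> edge_products E q" using leaf_edge_iff by simp
  have "{y, x} \<in> E" using leaf_edge_iff by simp
  then have "x \<in> V" using simple_graph_edge[OF G] by blast
  then have "Poly_Mapping.lookup m x = 0"
    using bd y by (force simp: lookup_add lookup_edge_mono extended_bound_def)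
  then have "m \<in> edge_products E' q" by (rule edge_products_delete_vertex[OF G m])
  moreover have "Poly_Mapping.lookup m v \<le> c v" if "v \<in> V'" for v
    using bd[rule_format, of v] that y
    by (auto simp: lookup_add lookup_edge_mono extended_bound_def split: if_splits)
  ultimately show ?thesis by (auto simp: bounded_edge_products_def)
qed

text \<open>
  If \<open>x\<close> does not occur, then the bound fails for \<open>G - x\<close> at most at \<open>y\<close>, and there by one;
  removing an edge at \<open>y\<close> repairs it.
\<close>

lemma bounded_edge_products_leaf:
  "bounded_edge_products V E (extended_bound c) (Suc q) \<noteq> {} \<longleftrightarrow>
   bounded_edge_products V' E' c q \<noteq> {}"
proof
  assume "bounded_edge_products V E (extended_bound c) (Suc q) \<noteq> {}"
  then obtain m where B: "m \<in> bounded_edge_products V E (extended_bound c) (Suc q)" by blast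
  then have m: "m \<in> edge_products E (Suc q)"
    and bd: "\<forall>v\<in>V. Poly_Mapping.lookup m v \<le> extended_bound c v"
    by (auto simp: bounded_edge_products_def)
  show "bounded_edge_products V' E' c q \<noteq> {}"
  proof (cases "Poly_Mapping.lookup m x = 0")
    case False
    then obtain m' u where "{u, x} \<in> E" "m = m' + edge_mono u x"
      using edge_products_factor_at[OF m, of x] by blast
    then have "m' + edge_mono y x \<in> bounded_edge_products V E (extended_bound c) (Suc q)"
      using B leaf_edge_iff by simp
    then show ?thesis using cancel_leaf_edge by blast
  next
    case True
    obtain m' u v where m': "m' \<in> edge_products E q" "m = m' + edge_mono u v"
      and at_y: "Poly_Mapping.lookup m y > 0 \<longrightarrow> v = y"
    proof (cases "Poly_Mapping.lookup m y > 0")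
      case True
      then show ?thesis using edge_products_factor_at[OF m True] that by blast
    next
      case False
      obtain m' u v where "m' \<in> edge_products E q" "m = m' + edge_mono u v"
        using m by auto
      with False show ?thesis by (intro that[of m' u v]) auto
    qed
    have "Poly_Mapping.lookup m' x = 0" using True m'(2) by (simp add: lookup_add)
    then have "m' \<in> edge_products E' q" by (rule edge_products_delete_vertex[OF G m'(1)])
    moreover have "Poly_Mapping.lookup m' w \<le> c w" if "w \<in> V'" for w
    proof (cases "w = y")
      case True
      show ?thesis
      proof (cases "Poly_Mapping.lookup m y > 0")
        case True
        then have "v = y" using at_y by blast
        then have "Suc (Poly_Mapping.lookup m' y) \<le> Poly_Mapping.lookup m y"
          unfolding m'(2) by (simp add: lookup_add lookup_edge_mono)
        also have "\<dots> \<le> Suc (c y)"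
          using bd that \<open>w = y\<close> by (force simp: extended_bound_def)
        finally show ?thesis using \<open>w = y\<close> by simp
      next
        case False
        moreover have "Poly_Mapping.lookup m' y \<le> Poly_Mapping.lookup m y"
          unfolding m'(2) by (simp add: lookup_add)
        ultimately show ?thesis using \<open>w = y\<close> by simp
      qed
    next
      case False
      have "Poly_Mapping.lookup m' w \<le> Poly_Mapping.lookup m w"
        unfolding m'(2) by (simp add: lookup_add)
      also have "\<dots> \<le> c w"
        using bd[rule_format, of w] that False by (simp add: extended_bound_def)
      finally show ?thesis .
    qed
    ultimately show ?thesis by (auto simp: bounded_edge_products_def)
  qed
qed (use times_leaf_edge in blast)

lemma greatest_length_leaf:
  "(GREATEST q. bounded_edge_products V E (extended_bound c) q \<noteq> {}) =
    Suc (GREATEST q. bounded_edge_products V' E' c q \<noteq> {})" (is "Greatest ?P = Suc (Greatest ?Q)")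
proof -
  have bound: "q \<le> (\<Sum>v\<in>V'. c v)" if "?Q q" for q
  proof -
    from that obtain m where m: "m \<in> edge_products E' q"
      and "\<forall>v\<in>V'. Poly_Mapping.lookup m v \<le> c v"
      by (auto simp: bounded_edge_products_def)
    then have "(\<Sum>v\<in>V'. Poly_Mapping.lookup m v) \<le> (\<Sum>v\<in>V'. c v)" by (intro sum_mono) auto
    then show ?thesis
      using edge_products_degree[OF simple_graph_delete_vertex[OF G] m] by simp
  qed
  have "?Q 0" by (simp add: bounded_edge_products_def)
  from GreatestI_nat[of ?Q, OF this bound] have Q: "?Q (Greatest ?Q)" .
  have max: "q \<le> Greatest ?Q" if "?Q q" for q
    using Greatest_le_nat[of ?Q, OF that bound] .
  show ?thesis
  proof (rule Greatest_equality)
    show "?P (Suc (Greatest ?Q))" using Q bounded_edge_products_leaf by blast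
    fix q assume "?P q"
    then show "q \<le> Suc (Greatest ?Q)"
      using max bounded_edge_products_leaf by (cases q) auto
  qed
qed

lemma strong_exchange_delete_leaf:
  assumes "graph_strong_exchange TYPE('k::field) V E"
  shows "graph_strong_exchange TYPE('k) V' E'"
  unfolding graph_strong_exchange_def
proof (intro allI impI)
  fix c :: "'v \<Rightarrow> nat" assume "\<forall>v\<in>V'. c v > 0"
  then have "\<forall>v\<in>V. extended_bound c v > 0" by (auto simp: extended_bound_def)
  then have ex: "strong_exchange V (graph_gens TYPE('k) V E (extended_bound c))"
    using assms by (auto simp: graph_strong_exchange_def)
  define d where "d = (GREATEST q. bounded_edge_products V' E' c q \<noteq> {})"
  have W: "graph_gens TYPE('k) V E (extended_bound c) =
      bounded_edge_products V E (extended_bound c) (Suc d)"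
    by (simp only: graph_gens_eq[OF G] greatest_length_leaf d_def)
  have W': "graph_gens TYPE('k) V' E' c = bounded_edge_products V' E' c d"
    by (simp only: graph_gens_eq[OF simple_graph_delete_vertex[OF G]] d_def)
  show "strong_exchange V' (graph_gens TYPE('k) V' E' c)"
    unfolding strong_exchange_def W'
  proof (intro ballI impI)
    fix w w' \<xi> \<rho>
    assume w: "w \<in> bounded_edge_products V' E' c d" "w' \<in> bounded_edge_products V' E' c d"
      and V: "\<xi> \<in> V'" "\<rho> \<in> V'"
      and less: "Poly_Mapping.lookup w' \<xi> < Poly_Mapping.lookup w \<xi> \<and>
        Poly_Mapping.lookup w \<rho> < Poly_Mapping.lookup w' \<rho>"
    let ?e = "edge_mono y x"
    have "Poly_Mapping.lookup (w' + ?e) \<xi> < Poly_Mapping.lookup (w + ?e) \<xi> \<and>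
        Poly_Mapping.lookup (w + ?e) \<rho> < Poly_Mapping.lookup (w' + ?e) \<rho>"
      using less by (simp add: lookup_add)
    then have "Poly_Mapping.single \<rho> 1 + (w + ?e - Poly_Mapping.single \<xi> 1)
        \<in> bounded_edge_products V E (extended_bound c) (Suc d)"
      using ex w V times_leaf_edge unfolding strong_exchange_def W by blast
    \<comment> \<open>Truncated subtraction is harmless here, because \<open>\<xi>\<close> occurs in \<open>w\<close>.\<close>
    moreover have "Poly_Mapping.single \<rho> 1 + (w + ?e - Poly_Mapping.single \<xi> 1) =
        (Poly_Mapping.single \<rho> 1 + (w - Poly_Mapping.single \<xi> 1)) + ?e"
      using less
      by (intro poly_mapping_eqI) (auto simp: lookup_add lookup_minus lookup_single when_def)
    ultimately show "Poly_Mapping.single \<rho> 1 + (w - Poly_Mapping.single \<xi> 1)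
        \<in> bounded_edge_products V' E' c d"
      using cancel_leaf_edge by simp
  qed
qed

end

theorem lemma4p4:
  fixes V :: "'v set" and E :: "'v set set" and x :: 'v
  assumes "simple_graph V E"
    and "\<And>v. \<not> isolated_vertex V E v"
    and "graph_strong_exchange TYPE('k::field) V E"
    and "leaf V E x"
  shows "graph_strong_exchange TYPE('k) (V - {x}) (induced_edges E (V - {x}))"
proof -
  obtain y where "y \<noteq> x" "\<And>u. {u, x} \<in> E \<longleftrightarrow> u = y"
    using leaf_obtain_neighbour[OF assms(1,4)] by metis
  then interpret leaf_edge V E x y
    using assms(1) by unfold_locales
  show ?thesis using assms(3) by (rule strong_exchange_delete_leaf)
qed

end
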